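(* Let $r > 0$, $M > 0$ and let $T$ be a positive integer. For every deterministic first-order algorithm $\mathcal{A}$, there exists an $M$-Lipschitz g-convex function $f \in \mathcal{F}_{r, M, 0, \infty}$ such that $\mathcal{A}$ requires at least $T$ queries to find a point $x$ with $f(x) - f^* \leq M r \cdot \frac{1}{2 \zeta_r \sqrt{T}}$, where $\zeta_r = \frac{r}{\tanh(r)}$; that is, $T_\delta(\mathcal{A}, f) \ge T$ with $\delta = \frac{M r}{2\zeta_r\sqrt{T}}$.
   Context: $\mathbb{H}^d$ ($d\ge 2$) is $d$-dimensional hyperbolic space of constant sectional curvature $-1$, with a fixed reference point $x_{\mathrm{ref}} = x_{\mathrm{ref}}^d\in \mathbb{H}^d$; $\mathrm{dist}$ is Riemannian distance, $B(x,r) = \{y : \mathrm{dist}(x,y)\le r\}$, $\log_x$ is the inverse of the exponential map $\exp_x$. Below, $\mathcal{M}=\mathbb{H}^d$. A function $f:\mathbb{H}^d\to\mathbb{R}$ is g-convex if $f(\gamma(t)) \le (1-t)f(x)+tf(y)$ for every geodesic $\gamma:[0,1]\to\mathbb{H}^d$ from $x$ to $y$ and $t\in[0,1]$. $f$ is $M$-Lipschitz if $|f(x)-f(y)|\le M\,\mathrm{dist}(x,y)$ for all $x,y$. A subgradient of $f$ at $x$ is $g\in \mathrm{T}_x\mathcal{M}$ with $f(y)\ge f(x)+\langle g,\log_x(y)\rangle$ for all $y$; $\partial f(x)$ is the set of subgradients. $f^*=\min f$. $\mathcal{F}^d_{r,M,0,\infty}$ is the class of functions $f:\mathbb{H}^d\to\mathbb{R}$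 that are globally $M$-Lipschitz, globally g-convex, and have a global minimizer in $B(x_{\mathrm{ref}},r)$ (no smoothness required); $\mathcal{F}_{r,M,0,\infty}=\bigcup_{d\ge 2}\mathcal{F}^d_{r,M,0,\infty}$. A deterministic first-order algorithm on $\mathcal{M}$ is a sequence of functions $\mathcal{A}_k:(\mathbb{R}\times \mathrm{T}\mathcal{M})^k\to\mathcal{M}$, $k\ge 0$ ($\mathcal{A}_0$ is just an initial point $x_0$); for a class that is a union over dimensions, an algorithm consists of one such sequence for each $\mathbb{H}^d$. Running $\mathcal{A}$ on $f$ produces $x_k=\mathcal{A}_k\big((f(x_\ell),(x_\ell,g_\ell))_{\ell=0}^{k-1}\big)$, where $g_\ell\in\partial f(x_\ell)$ is returned by an oracle associated to $f$ (each function is implicitly given together with such an oracle, a map returning at each $x$ the value $f(x)$ and one element of $\partial f(x)$). $T_\delta(\mathcal{A},f)$ is the first index $k$ (starting from $0$) with $f(x_k)-f^*\le\delta$. *)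

theory Defs
  imports "HOL-Analysis.Analysis" "HOL-Library.Extended_Nat"
begin

section \<open>Hyperbolic space: the hyperboloid model\<close>

text \<open>
  The dimension \<open>d\<close> is quantified inside the main statement, so it is a natural number and not
  a type. Vectors of \<open>\<real>\<^bsup>d+1\<^esup>\<close> are functions on \<open>nat\<close> that vanish at every
  index above \<open>d\<close>; index 0 is the time-like coordinate. The Riemannian metric of \<open>hyp d\<close> is
  the restriction of the Minkowski form \<open>mink d\<close> to the tangent spaces, which gives constant
  sectional curvature -1.
\<close>

type_synonym vec = "nat \<Rightarrow> real"

definition mink :: "nat \<Rightarrow> vec \<Rightarrow> vec \<Rightarrow> real" where
  "mink d u v = (\<Sum>i=1..d. u i * v i) - u 0 * v 0"

definition hyp :: "nat \<Rightarrow> vec set" where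
  "hyp d = {x. (\<forall>i>d. x i = 0) \<and> mink d x x = -1 \<and> x 0 > 0}"

definition tangent :: "nat \<Rightarrow> vec \<Rightarrow> vec set" where
  "tangent d x = {v. (\<forall>i>d. v i = 0) \<and> mink d x v = 0}"

definition hnorm :: "nat \<Rightarrow> vec \<Rightarrow> real" where
  "hnorm d v = sqrt (mink d v v)"

definition hdist :: "nat \<Rightarrow> vec \<Rightarrow> vec \<Rightarrow> real" where
  "hdist d x y = arcosh (- mink d x y)"

definition hball :: "nat \<Rightarrow> vec \<Rightarrow> real \<Rightarrow> vec set" where
  "hball d x r = {y \<in> hyp d. hdist d x y \<le> r}"

text \<open>For \<open>v = 0\<close> the second summand vanishes, so that \<open>hexp d x 0 = x\<close>.\<close>

definition hexp :: "nat \<Rightarrow> vec \<Rightarrow> vec \<Rightarrow> vec" where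
  "hexp d x v = (\<lambda>i. cosh (hnorm d v) * x i + sinh (hnorm d v) / hnorm d v * v i)"

text \<open>\<open>hexp d x\<close> is a bijection from \<open>tangent d x\<close> onto \<open>hyp d\<close>: see \<open>bij_betw_hexp\<close> below.\<close>

definition hlog :: "nat \<Rightarrow> vec \<Rightarrow> vec \<Rightarrow> vec" where
  "hlog d x = inv_into (tangent d x) (hexp d x)"

definition hgeodesic :: "nat \<Rightarrow> vec \<Rightarrow> vec \<Rightarrow> (real \<Rightarrow> vec) \<Rightarrow> bool" where
  "hgeodesic d x y \<gamma> \<longleftrightarrow> x \<in> hyp d \<and> y \<in> hyp d \<and>
     (\<exists>v \<in> tangent d x. (\<forall>t\<in>{0..1}. \<gamma> t = hexp d x (\<lambda>i. t * v i))) \<and> \<gamma> 0 = x \<and> \<gamma> 1 = y"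


subsection \<open>Consistency of exponential map, logarithm and distance\<close>

lemma mink_commute: "mink d u v = mink d v u"
  by (simp add: mink_def mult.commute)

lemma mink_lincomb_right:
  "mink d u (\<lambda>i. a * v i + b * w i) = a * mink d u v + b * mink d u w"
  by (simp add: mink_def algebra_simps sum.distrib sum_distrib_left)

lemma mink_lincomb_left:
  "mink d (\<lambda>i. a * v i + b * w i) u = a * mink d v u + b * mink d w u"
  using mink_lincomb_right[of d u a v b w] by (simp add: mink_commute)

lemma mink_zero [simp]: "mink d (\<lambda>_. 0) v = 0" "mink d v (\<lambda>_. 0) = 0"
  by (simp_all add: mink_def)

lemma hyp_sum_squares:
  assumes "x \<in> hyp d" shows "(\<Sum>i=1..d. (x i)\<^sup>2) = (x 0)\<^sup>2 - 1"
  using assms by (simp add: hyp_def mink_def power2_eq_square)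

lemma tangent_posdef:
  assumes x: "x \<in> hyp d" and v: "v \<in> tangent d x"
  shows "mink d v v \<ge> 0" and "mink d v v = 0 \<longleftrightarrow> v = (\<lambda>_. 0)"
proof -
  define S where "S = (\<Sum>i=1..d. (v i)\<^sup>2)"
  have S: "S \<ge> 0" by (simp add: S_def sum_nonneg)
  have q: "mink d v v = S - (v 0)\<^sup>2" by (simp add: S_def mink_def power2_eq_square)
  have "(x 0 * v 0)\<^sup>2 = (\<Sum>i=1..d. x i * v i)\<^sup>2"
    using v by (simp add: tangent_def mink_def)
  also have "\<dots> \<le> ((x 0)\<^sup>2 - 1) * S"
    unfolding S_def hyp_sum_squares[OF x, symmetric] by (rule Cauchy_Schwarz_ineq_sum)
  finally have *: "S \<le> (x 0)\<^sup>2 * mink d v v"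
    by (simp add: q algebra_simps power_mult_distrib)
  have x0: "(x 0)\<^sup>2 > 0" using x by (simp add: hyp_def)
  show "mink d v v \<ge> 0"
    using * S mult_pos_neg[OF x0, of "mink d v v"] by linarith
  show "mink d v v = 0 \<longleftrightarrow> v = (\<lambda>_. 0)"
  proof
    assume 0: "mink d v v = 0"
    have "S = 0" using * S 0 by simp
    hence i: "\<forall>i\<in>{1..d}. v i = 0" by (simp add: S_def sum_nonneg_eq_0_iff)
    have "v 0 = 0" using q 0 \<open>S = 0\<close> by simp
    moreover have "\<forall>i>d. v i = 0" using v by (simp add: tangent_def)
    ultimately have "v j = 0" for j using i by (cases "j = 0"; cases "j > d") auto
    thus "v = (\<lambda>_. 0)" by auto
  qed auto
qed

lemma hnorm_squared:
  assumes "x \<in> hyp d" "v \<in> tangent d x"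
  shows "(hnorm d v)\<^sup>2 = mink d v v" "hnorm d v \<ge> 0" "hnorm d v = 0 \<longleftrightarrow> v = (\<lambda>_. 0)"
  using tangent_posdef[OF assms] by (auto simp: hnorm_def)

lemma hyp_spatial_less:
  assumes x: "x \<in> hyp d" and y: "mink d y y = -1" "y 0 \<noteq> 0"
  shows "\<bar>\<Sum>i=1..d. x i * y i\<bar> < x 0 * \<bar>y 0\<bar>"
proof -
  have sy: "(\<Sum>i=1..d. (y i)\<^sup>2) = (y 0)\<^sup>2 - 1"
    using y(1) by (simp add: mink_def power2_eq_square)
  have sx0: "(x 0)\<^sup>2 \<ge> 1"
    using hyp_sum_squares[OF x] sum_nonneg[of "{1..d}" "\<lambda>i. (x i)\<^sup>2"] by fastforce
  have sy0: "(y 0)\<^sup>2 \<ge> 1"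
    using sy sum_nonneg[of "{1..d}" "\<lambda>i. (y i)\<^sup>2"] by fastforce
  have "(\<Sum>i=1..d. x i * y i)\<^sup>2 \<le> ((x 0)\<^sup>2 - 1) * ((y 0)\<^sup>2 - 1)"
    unfolding hyp_sum_squares[OF x, symmetric] sy[symmetric] by (rule Cauchy_Schwarz_ineq_sum)
  also have "\<dots> < (x 0 * \<bar>y 0\<bar>)\<^sup>2"
  proof -
    have "(x 0 * \<bar>y 0\<bar>)\<^sup>2 = (x 0)\<^sup>2 * (y 0)\<^sup>2" by (simp add: power_mult_distrib)
    moreover have "((x 0)\<^sup>2 - 1) * ((y 0)\<^sup>2 - 1) = (x 0)\<^sup>2 * (y 0)\<^sup>2 - (x 0)\<^sup>2 - (y 0)\<^sup>2 + 1"
      by (simp add: algebra_simps)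
    ultimately show ?thesis using sx0 sy0 by linarith
  qed
  finally have "\<bar>\<Sum>i=1..d. x i * y i\<bar>\<^sup>2 < (x 0 * \<bar>y 0\<bar>)\<^sup>2"
    by (simp only: power2_abs)
  moreover have "0 \<le> x 0 * \<bar>y 0\<bar>" using x by (simp add: hyp_def)
  ultimately show ?thesis by (rule power2_less_imp_less)
qed

lemma mink_x_hexp:
  assumes "x \<in> hyp d" "v \<in> tangent d x"
  shows "mink d x (hexp d x v) = - cosh (hnorm d v)"
  using assms unfolding hexp_def mink_lincomb_right by (simp add: hyp_def tangent_def)

lemma hexp_in_hyp:
  assumes x: "x \<in> hyp d" and v: "v \<in> tangent d x"
  shows "hexp d x v \<in> hyp d"
proof -
  define n where "n = hnorm d v"
  define y where "y = hexp d x v"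
  have xx: "mink d x x = -1" and xv: "mink d x v = 0" "mink d v x = 0"
    using x v by (auto simp: hyp_def tangent_def mink_commute)
  have n2: "mink d v v = n\<^sup>2" using hnorm_squared[OF x v] by (simp add: n_def)
  have "mink d y y = - (cosh n)\<^sup>2 + (sinh n / n)\<^sup>2 * n\<^sup>2"
    unfolding y_def hexp_def n_def[symmetric] mink_lincomb_left mink_lincomb_right xx xv n2
    by (simp add: power2_eq_square)
  also have "(sinh n / n)\<^sup>2 * n\<^sup>2 = (sinh n)\<^sup>2" by (simp add: power_divide)
  finally have yy: "mink d y y = -1" by (simp add: cosh_square_eq)
  have xy: "mink d x y \<le> -1"
    using mink_x_hexp[OF x v] cosh_real_ge_1[of n] by (simp add: y_def n_def)
  have y0: "y 0 \<noteq> 0"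
  proof
    assume "y 0 = 0"
    moreover have "(\<Sum>i=1..d. y i * y i) \<ge> 0" by (simp add: sum_nonneg)
    ultimately show False using yy by (simp add: mink_def)
  qed
  have "y 0 > 0"
  proof (rule ccontr)
    assume "\<not> y 0 > 0"
    hence "\<bar>y 0\<bar> = - y 0" by simp
    thus False using hyp_spatial_less[OF x yy y0] xy by (simp add: mink_def)
  qed
  thus ?thesis using yy x v
    by (auto simp: y_def hyp_def tangent_def hexp_def)
qed

lemma hdist_hexp:
  assumes "x \<in> hyp d" "v \<in> tangent d x"
  shows "hdist d x (hexp d x v) = hnorm d v"
  using mink_x_hexp[OF assms] hnorm_squared(2)[OF assms]
  by (simp add: hdist_def arcosh_cosh_real)

lemma bij_betw_hexp:
  assumes x: "x \<in> hyp d"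
  shows "bij_betw (hexp d x) (tangent d x) (hyp d)"
proof (rule bij_betw_imageI)
  show "inj_on (hexp d x) (tangent d x)"
  proof (rule inj_onI)
    fix v w assume v: "v \<in> tangent d x" and w: "w \<in> tangent d x" and e: "hexp d x v = hexp d x w"
    have n: "hnorm d v = hnorm d w"
      using hdist_hexp[OF x v] hdist_hexp[OF x w] e by simp
    show "v = w"
    proof (cases "hnorm d v = 0")
      case True
      thus ?thesis using n hnorm_squared(3)[OF x v] hnorm_squared(3)[OF x w] by simp
    next
      case False
      have "v i = w i" for i
        using fun_cong[OF e, of i] False by (simp add: hexp_def n)
      thus ?thesis by auto
    qed
  qed
  show "hexp d x ` tangent d x = hyp d"
  proof (intro equalityI subsetI)
    fix y assume "y \<in> hexp d x ` tangent d x"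
    thus "y \<in> hyp d" using hexp_in_hyp[OF x] by auto
  next
    fix y assume y: "y \<in> hyp d"
    define c where "c = - mink d x y"
    define u where "u = (\<lambda>i. 1 * y i + (- c) * x i)"
    have xx: "mink d x x = -1" and yy: "mink d y y = -1" and
      xy: "mink d x y = - c" "mink d y x = - c"
      using x y by (auto simp: hyp_def c_def mink_commute)
    have "mink d x u = 0"
      by (simp only: u_def mink_lincomb_right) (simp add: xx xy)
    hence u: "u \<in> tangent d x" using x y by (auto simp: tangent_def hyp_def u_def)
    have uu: "mink d u u = c\<^sup>2 - 1"
      by (simp only: u_def mink_lincomb_right mink_lincomb_left xx yy xy)
        (simp add: power2_eq_square)
    have "c > 0"
      using hyp_spatial_less[OF x yy] y by (auto simp: c_def mink_def hyp_def)
    have "c\<^sup>2 \<ge> 1" using tangent_posdef(1)[OF x u] uu by simp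
    hence c1: "c \<ge> 1" using \<open>c > 0\<close> power2_le_imp_le[of 1 c] by simp
    define th where "th = arcosh c"
    have th: "cosh th = c" "th \<ge> 0" using c1 by (auto simp: th_def)
    define v where "v = (\<lambda>i. 0 * u i + th / sinh th * u i)"
    have "mink d x v = 0"
      unfolding v_def mink_lincomb_right using \<open>mink d x u = 0\<close> by simp
    hence v: "v \<in> tangent d x" using u by (auto simp: tangent_def v_def)
    have "hexp d x v = y"
    proof (cases "c = 1")
      case True
      hence "u = (\<lambda>_. 0)" using tangent_posdef(2)[OF x u] uu by simp
      hence "v = (\<lambda>_. 0)" "y = x" using True by (auto simp: v_def u_def fun_eq_iff)
      thus ?thesis by (simp add: hexp_def hnorm_def)
    next
      case False
      hence tp: "th > 0" using c1 by (simp add: th_def)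
      have "mink d v v = (th / sinh th)\<^sup>2 * (c\<^sup>2 - 1)"
        by (simp only: v_def mink_lincomb_right mink_lincomb_left uu) (simp add: power2_eq_square)
      also have "c\<^sup>2 - 1 = (sinh th)\<^sup>2" by (simp add: th(1)[symmetric] cosh_square_eq)
      finally have "mink d v v = th\<^sup>2" using tp by (simp add: power_divide)
      hence "hnorm d v = th" using tp by (simp add: hnorm_def)
      thus ?thesis using tp th(1) by (auto simp: hexp_def v_def u_def fun_eq_iff)
    qed
    thus "y \<in> hexp d x ` tangent d x" using v by blast
  qed
qed


section \<open>Geodesically convex Lipschitz functions\<close>

text \<open>Only the values of a function on \<open>hyp d\<close> matter in the following definitions.\<close>

definition g_convex :: "nat \<Rightarrow> (vec \<Rightarrow> real) \<Rightarrow> bool" where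
  "g_convex d f \<longleftrightarrow> (\<forall>x y \<gamma>. hgeodesic d x y \<gamma> \<longrightarrow>
     (\<forall>t\<in>{0..1}. f (\<gamma> t) \<le> (1 - t) * f x + t * f y))"

definition h_lipschitz :: "nat \<Rightarrow> real \<Rightarrow> (vec \<Rightarrow> real) \<Rightarrow> bool" where
  "h_lipschitz d M f \<longleftrightarrow> (\<forall>x\<in>hyp d. \<forall>y\<in>hyp d. \<bar>f x - f y\<bar> \<le> M * hdist d x y)"

definition subdifferential :: "nat \<Rightarrow> (vec \<Rightarrow> real) \<Rightarrow> vec \<Rightarrow> vec set" where
  "subdifferential d f x =
     {g \<in> tangent d x. \<forall>y\<in>hyp d. f y \<ge> f x + mink d g (hlog d x y)}"

definition h_min :: "nat \<Rightarrow> (vec \<Rightarrow> real) \<Rightarrow> real" where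
  "h_min d f = (LEAST m. m \<in> f ` hyp d)"

definition lip_class :: "nat \<Rightarrow> vec \<Rightarrow> real \<Rightarrow> real \<Rightarrow> (vec \<Rightarrow> real) set" where
  "lip_class d x_ref r M = {f. h_lipschitz d M f \<and> g_convex d f \<and>
     (\<exists>z \<in> hball d x_ref r. \<forall>y\<in>hyp d. f z \<le> f y)}"


section \<open>Deterministic first-order algorithms\<close>

text \<open>
  An algorithm maps a query history, a list of entries \<open>(f x, (x, g))\<close>, oldest entry first, to the
  next query point. Its restriction to lists of length \<open>k\<close> is the \<open>k\<close>-th function of the sequence;
  its value on the empty list is the initial point.
\<close>

type_synonym history = "(real \<times> (vec \<times> vec)) list"

definition tangent_bundle :: "nat \<Rightarrow> (vec \<times> vec) set" where
  "tangent_bundle d = (SIGMA x:hyp d. tangent d x)"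

definition first_order_algorithm :: "nat \<Rightarrow> (history \<Rightarrow> vec) \<Rightarrow> bool" where
  "first_order_algorithm d A \<longleftrightarrow> (\<forall>h \<in> lists (UNIV \<times> tangent_bundle d). A h \<in> hyp d)"

definition subgradient_oracle :: "nat \<Rightarrow> (vec \<Rightarrow> real) \<Rightarrow> (vec \<Rightarrow> vec) \<Rightarrow> bool" where
  "subgradient_oracle d f G \<longleftrightarrow> (\<forall>x\<in>hyp d. G x \<in> subdifferential d f x)"

primrec query_history ::
    "(history \<Rightarrow> vec) \<Rightarrow> (vec \<Rightarrow> real) \<Rightarrow> (vec \<Rightarrow> vec) \<Rightarrow> nat \<Rightarrow> history" where
  "query_history A f G 0 = []"
| "query_history A f G (Suc k) =
     (let h = query_history A f G k; x = A h in h @ [(f x, (x, G x))])"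

definition query_point ::
    "(history \<Rightarrow> vec) \<Rightarrow> (vec \<Rightarrow> real) \<Rightarrow> (vec \<Rightarrow> vec) \<Rightarrow> nat \<Rightarrow> vec" where
  "query_point A f G k = A (query_history A f G k)"

text \<open>The value is \<open>\<infinity>\<close> if no query point is \<open>\<delta>\<close>-optimal.\<close>

definition query_complexity ::
    "nat \<Rightarrow> real \<Rightarrow> (history \<Rightarrow> vec) \<Rightarrow> (vec \<Rightarrow> real) \<Rightarrow> (vec \<Rightarrow> vec) \<Rightarrow> enat" where
  "query_complexity d \<delta> A f G = Inf {enat k |k. f (query_point A f G k) - h_min d f \<le> \<delta>}"

definition zeta :: "real \<Rightarrow> real" where
  "zeta r = r / tanh r"

end

theory Submission
  imports Defs
begin

text \<open>
  The hard function is \<open>M\<close> times the largest of the distances to \<open>T\<close> half-spaces. Their unit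
  normals are \<open>(e - c p) / sqrt (1 - c\<^sup>2)\<close>, where \<open>p\<close> is the reference point,
  \<open>c = tanh r / sqrt T\<close> and \<open>e\<close> runs through an orthonormal family in the tangent space at \<open>p\<close>.
  The constant \<open>c\<close> is such that all boundaries meet in the point at distance \<open>r\<close> from \<open>p\<close> in
  direction \<open>- (\<Sum> e) / sqrt T\<close>, so the minimum is 0. If some \<open>e\<close> is orthogonal to a query
  point, then the function is there at least \<open>M artanh c \<ge> M c\<close>, twice the required gap, no
  matter how far the point is from \<open>p\<close>. In dimension \<open>2 T + 1\<close> an adversary can choose the \<open>k\<close>-th direction orthogonal to
  the first \<open>k\<close> queries. Convexity and the Lipschitz bound are both consequences of the existence
  of subgradients of norm at most \<open>M\<close>.
\<close>

section \<open>Hyperbolic inequalities\<close>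

lemma sinh_le_mult_cosh:
  fixes t :: real assumes "t \<ge> 0" shows "sinh t \<le> t * cosh t"
proof -
  have "(0::real) * cosh 0 - sinh 0 \<le> t * cosh t - sinh t"
  proof (rule DERIV_nonneg_imp_nondecreasing[OF assms])
    fix x :: real assume x: "0 \<le> x" "x \<le> t"
    have "((\<lambda>x. x * cosh x - sinh x) has_real_derivative (x * sinh x)) (at x)"
      by (auto intro!: derivative_eq_intros)
    then show "\<exists>y. ((\<lambda>x. x * cosh x - sinh x) has_real_derivative y) (at x) \<and> y \<ge> 0"
      using x by auto
  qed
  then show ?thesis by simp
qed

lemma le_sinh:
  fixes t :: real assumes "t \<ge> 0" shows "t \<le> sinh t"
  using real_le_x_sinh[OF assms] by (simp add: sinh_def exp_minus)

text \<open>The numerator of the derivative is \<open>x * cosh x - sinh x \<ge> 0\<close>. This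
  settles steps away from the hyperplane in \<open>sinh_add_le\<close>.\<close>

lemma sinh_over_self_mono:
  fixes s l :: real assumes "0 < s" "s \<le> l" shows "sinh s / s \<le> sinh l / l"
proof (rule DERIV_nonneg_imp_nondecreasing[OF assms(2)])
  fix x :: real assume x: "s \<le> x" "x \<le> l"
  then have "x > 0" using assms by simp
  then have "((\<lambda>x. sinh x / x) has_real_derivative ((cosh x * x - sinh x) / (x * x))) (at x)"
    by (auto intro!: derivative_eq_intros simp: field_simps)
  moreover have "(cosh x * x - sinh x) / (x * x) \<ge> 0"
    using sinh_le_mult_cosh[of x] \<open>x > 0\<close> by (simp add: mult.commute)
  ultimately show "\<exists>y. ((\<lambda>x. sinh x / x) has_real_derivative y) (at x) \<and> y \<ge> 0"
    by blast
qed

text \<open>The sign of the derivative reduces to \<open>x \<le> sinh x * cosh x\<close>. This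
  settles steps towards the hyperplane in \<open>sinh_add_le\<close>.\<close>

lemma tanh_over_self_antimono:
  fixes s l :: real assumes "0 < s" "s \<le> l" shows "tanh l / l \<le> tanh s / s"
proof (rule DERIV_nonpos_imp_nonincreasing[OF assms(2)])
  fix x :: real assume x: "s \<le> x" "x \<le> l"
  then have "x > 0" using assms by simp
  then have "((\<lambda>x. tanh x / x) has_real_derivative
      (((1 - (tanh x)\<^sup>2) * x - tanh x) / (x * x))) (at x)"
    by (auto intro!: derivative_eq_intros simp: field_simps)
  moreover have "((1 - (tanh x)\<^sup>2) * x - tanh x) / (x * x) \<le> 0"
  proof -
    have "x \<le> sinh x * 1" using le_sinh[of x] \<open>x > 0\<close> by simp
    also have "\<dots> \<le> sinh x * cosh x"
      using \<open>x > 0\<close> cosh_real_ge_1[of x] by (intro mult_left_mono) auto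
    finally have "x / (cosh x)\<^sup>2 \<le> sinh x * cosh x / (cosh x)\<^sup>2"
      by (intro divide_right_mono) auto
    also have "\<dots> = tanh x" by (simp add: tanh_def power2_eq_square)
    finally have "x / (cosh x)\<^sup>2 \<le> tanh x" .
    moreover have "1 - (tanh x)\<^sup>2 = 1 / (cosh x)\<^sup>2"
      by (simp add: tanh_def power_divide diff_divide_eq_iff sinh_square_eq)
    ultimately have "(1 - (tanh x)\<^sup>2) * x - tanh x \<le> 0" by simp
    then show ?thesis using \<open>x > 0\<close> by (simp add: divide_nonpos_pos)
  qed
  ultimately show "\<exists>y. ((\<lambda>x. tanh x / x) has_real_derivative y) (at x) \<and> y \<le> 0"
    by blast
qed

text \<open>This is the subgradient inequality for the signed distance to a hyperplane at a point at
  distance \<open>a\<close> from it: \<open>l\<close> is the length of the step and \<open>s\<close> its component along the gradient.\<close>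

lemma sinh_add_le:
  fixes a s l :: real
  assumes "a \<ge> 0" "\<bar>s\<bar> \<le> l" "l > 0" "a + s \<ge> 0"
  shows "sinh (a + s) \<le> sinh a * cosh l + cosh a * (sinh l / l * s)"
proof -
  have cs: "cosh s \<le> cosh l"
    using cosh_real_nonneg_le_iff[of "\<bar>s\<bar>" l] assms by simp
  consider "s = 0" | "s > 0" | "s < 0" by linarith
  then show ?thesis
  proof cases
    case 1
    then show ?thesis
      using assms cosh_real_ge_1[of l] mult_left_mono[of 1 "cosh l" "sinh a"] by simp
  next
    case 2
    have "sinh s / s * s \<le> sinh l / l * s"
      using sinh_over_self_mono[of s l] 2 assms by (intro mult_right_mono) auto
    then have "sinh s \<le> sinh l / l * s" using 2 by simp
    then show ?thesis
      using cs assms unfolding sinh_add by (intro add_mono mult_left_mono) auto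
  next
    case 3
    \<comment> \<open>Divided by \<open>cosh a\<close>, the claim reads
      \<open>sinh l / l * q - sinh q \<le> tanh a * (cosh l - cosh q)\<close>. Since
      \<open>q \<le> a\<close>, it suffices to have it with \<open>tanh q\<close> for
      \<open>tanh a\<close>, and that is \<open>tanh l / l \<le> tanh q / q\<close>.\<close>
    define q where "q = - s"
    have q: "q > 0" "q \<le> l" "q \<le> a" using 3 assms by (auto simp: q_def)
    have "tanh l / l \<le> tanh q / q" by (rule tanh_over_self_antimono) (use q in auto)
    then have "tanh l / l * q \<le> tanh q" using q by (simp add: field_simps)
    then have "tanh l / l * q * cosh l \<le> tanh q * cosh l"
      by (intro mult_right_mono) auto
    then have A: "sinh l / l * q \<le> tanh q * cosh l" by (simp add: tanh_def)
    have "tanh q * (cosh l - cosh q) \<le> tanh a * (cosh l - cosh q)"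
      using q(3) cs by (intro mult_right_mono) (simp_all only: tanh_real_le_iff diff_ge_0_iff_ge, simp add: q_def)
    then have "sinh l / l * q - sinh q \<le> tanh a * (cosh l - cosh q)"
      using A by (simp add: algebra_simps) (simp add: tanh_def)
    then have "cosh a * (sinh l / l * q - sinh q) \<le> cosh a * (tanh a * (cosh l - cosh q))"
      by (intro mult_left_mono) auto
    also have "\<dots> = sinh a * (cosh l - cosh q)" by (simp add: tanh_def)
    finally show ?thesis by (simp add: sinh_add q_def algebra_simps)
  qed
qed

lemma tanh_le_self:
  fixes t :: real assumes "t \<ge> 0" shows "tanh t \<le> t"
  using sinh_le_mult_cosh[OF assms] by (simp add: tanh_def divide_le_eq)


section \<open>Subgradients on the hyperboloid\<close>

lemma tangent_lincomb:
  assumes "u \<in> tangent d x" "v \<in> tangent d x"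
  shows "(\<lambda>i. a * u i + b * v i) \<in> tangent d x"
  using assms by (simp add: tangent_def mink_lincomb_right)

lemma tangent_scale: "v \<in> tangent d x \<Longrightarrow> (\<lambda>i. a * v i) \<in> tangent d x"
  using tangent_lincomb[of v d x v a 0] by simp

lemma mink_scale_right: "mink d u (\<lambda>i. a * v i) = a * mink d u v"
  using mink_lincomb_right[of d u a v 0 v] by simp

lemma mink_scale_left: "mink d (\<lambda>i. a * v i) u = a * mink d v u"
  using mink_lincomb_left[of d a v 0 v u] by simp

text \<open>The Minkowski form is indefinite but positive definite on a tangent space, so the usual
  argument applies: \<open>w\<close> is a multiple of the part of \<open>u\<close> orthogonal to
  \<open>v\<close>, and \<open>mink d w w \<ge> 0\<close>.\<close>

lemma mink_Cauchy_Schwarz: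
  assumes x: "x \<in> hyp d" and u: "u \<in> tangent d x" and v: "v \<in> tangent d x"
  shows "\<bar>mink d u v\<bar> \<le> hnorm d u * hnorm d v"
proof (cases "mink d v v = 0")
  case True
  then have "v = (\<lambda>_. 0)" using tangent_posdef[OF x v] by simp
  then show ?thesis by (simp add: hnorm_def)
next
  case False
  then have pos: "mink d v v > 0" using tangent_posdef[OF x v] by simp
  define w where "w = (\<lambda>i. mink d v v * u i + (- mink d u v) * v i)"
  have "w \<in> tangent d x" unfolding w_def by (rule tangent_lincomb[OF u v])
  then have "0 \<le> mink d w w" by (rule tangent_posdef[OF x])
  also have "mink d w w = mink d v v * (mink d v v * mink d u u - (mink d u v)\<^sup>2)"
    by (simp only: w_def mink_lincomb_left mink_lincomb_right mink_commute[of d v u])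
      (simp add: algebra_simps power2_eq_square)
  finally have "(mink d u v)\<^sup>2 \<le> mink d u u * mink d v v"
    using pos by (simp add: zero_le_mult_iff mult.commute)
  then have "sqrt ((mink d u v)\<^sup>2) \<le> sqrt (mink d u u * mink d v v)"
    by (rule real_sqrt_le_mono)
  then show ?thesis by (simp add: hnorm_def real_sqrt_mult)
qed

lemma hlog_in_tangent:
  assumes "x \<in> hyp d" "y \<in> hyp d" shows "hlog d x y \<in> tangent d x"
  unfolding hlog_def using bij_betw_hexp[OF assms(1)] assms(2)
  by (auto simp: bij_betw_def intro: inv_into_into)

lemma hexp_hlog:
  assumes "x \<in> hyp d" "y \<in> hyp d" shows "hexp d x (hlog d x y) = y"
  unfolding hlog_def using bij_betw_hexp[OF assms(1)] assms(2)
  by (metis bij_betw_imp_surj_on f_inv_into_f)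

lemma hlog_hexp:
  assumes "x \<in> hyp d" "v \<in> tangent d x" shows "hlog d x (hexp d x v) = v"
  unfolding hlog_def using bij_betw_hexp[OF assms(1)] assms(2)
  by (auto simp: bij_betw_def intro: inv_into_f_f)

lemma hnorm_hlog:
  assumes "x \<in> hyp d" "y \<in> hyp d" shows "hnorm d (hlog d x y) = hdist d x y"
  using hdist_hexp[OF assms(1) hlog_in_tangent[OF assms]] by (simp add: hexp_hlog[OF assms])

lemma hdist_commute: "hdist d x y = hdist d y x"
  by (simp add: hdist_def mink_commute)

lemma mink_hyp_le:
  assumes "x \<in> hyp d" "y \<in> hyp d" shows "mink d x y \<le> -1"
  using mink_x_hexp[OF assms(1) hlog_in_tangent[OF assms]] cosh_real_ge_1[of "hnorm d (hlog d x y)"]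
  by (simp add: hexp_hlog[OF assms])

section \<open>Geodesics re-based at an inner point; convexity and Lipschitz bound from
  subgradients\<close>

lemma hexp_scale:
  assumes n: "mink d v v = n\<^sup>2" "n > 0"
  shows "hexp d x (\<lambda>i. t * v i) = (\<lambda>i. cosh (t * n) * x i + sinh (t * n) / n * v i)"
proof -
  have h: "hnorm d (\<lambda>i. t * v i) = \<bar>t\<bar> * n"
    using n by (simp add: hnorm_def mink_scale_left mink_scale_right real_sqrt_mult)
  show ?thesis
  proof (cases "t \<ge> 0")
    case True
    then show ?thesis using n by (cases "t = 0") (auto simp: hexp_def h, simp add: hnorm_def)
  next
    case False
    then show ?thesis using n by (auto simp: hexp_def h)
  qed
qed

lemma hexp_reparametrize:
  assumes x: "x \<in> hyp d" and v: "v \<in> tangent d x"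
  obtains w where "w \<in> tangent d (hexp d x (\<lambda>i. t * v i))"
    "\<And>s. hexp d (hexp d x (\<lambda>i. t * v i)) (\<lambda>i. s * w i) = hexp d x (\<lambda>i. (t + s) * v i)"
proof (cases "v = (\<lambda>_. 0)")
  case True
  have "(\<lambda>_. 0) \<in> tangent d (hexp d x (\<lambda>i. t * v i))" by (simp add: tangent_def)
  moreover have "hexp d y (\<lambda>_. 0) = y" for y by (simp add: hexp_def hnorm_def)
  ultimately show ?thesis using True by (intro that[of "\<lambda>_. 0"]) auto
next
  case False
  define n where "n = hnorm d v"
  have n: "mink d v v = n\<^sup>2" "n > 0"
    using hnorm_squared[OF x v] False by (auto simp: n_def less_le)
  define m where "m = hexp d x (\<lambda>i. t * v i)"
  have m: "m = (\<lambda>i. cosh (t * n) * x i + sinh (t * n) / n * v i)"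
    unfolding m_def by (rule hexp_scale[OF n])
  \<comment> \<open>The velocity of the geodesic at time \<open>t\<close>, obtained by
    differentiating the formula for \<open>m\<close> in \<open>t\<close>.\<close>
  define w where "w = (\<lambda>i. n * sinh (t * n) * x i + cosh (t * n) * v i)"
  have xx: "mink d x x = -1" and xv: "mink d x v = 0" "mink d v x = 0"
    using x v by (auto simp: hyp_def tangent_def mink_commute)
  have "mink d m w = 0"
    unfolding m w_def mink_lincomb_left mink_lincomb_right xx xv n
    using n(2) by (simp add: power2_eq_square)
  moreover have "\<forall>i>d. w i = 0" using x v by (auto simp: w_def hyp_def tangent_def)
  ultimately have w: "w \<in> tangent d m" by (simp add: tangent_def)
  have ww: "mink d w w = n\<^sup>2"
  proof -
    have "mink d w w = n\<^sup>2 * ((cosh (t * n))\<^sup>2 - (sinh (t * n))\<^sup>2)"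
      unfolding w_def mink_lincomb_left mink_lincomb_right xx xv n
      by (simp add: power2_eq_square algebra_simps)
    then show ?thesis by (simp add: hyperbolic_pythagoras)
  qed
  have "hexp d m (\<lambda>i. s * w i) = hexp d x (\<lambda>i. (t + s) * v i)" for s
    unfolding hexp_scale[OF ww n(2)] hexp_scale[OF n]
    using n(2) by (auto simp: fun_eq_iff m w_def cosh_add sinh_add field_simps)
  with w show ?thesis using that unfolding m_def by blast
qed

text \<open>Seen from the inner point \<open>m\<close>, the logarithms of the two ends are
  \<open>- t\<close> and \<open>1 - t\<close> times the same vector \<open>w\<close>. In the
  weighted sum of the two subgradient inequalities at \<open>m\<close> the linear terms
  cancel.\<close>

lemma g_convex_if_subgradients:
  assumes "\<And>x. x \<in> hyp d \<Longrightarrow> subdifferential d f x \<noteq> {}"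
  shows "g_convex d f"
  unfolding g_convex_def
proof (intro allI impI ballI)
  fix x y \<gamma> and t :: real
  assume g: "hgeodesic d x y \<gamma>" and t: "t \<in> {0..1}"
  obtain v where v: "v \<in> tangent d x" and \<gamma>: "\<And>t. t \<in> {0..1} \<Longrightarrow> \<gamma> t = hexp d x (\<lambda>i. t * v i)"
    and xy: "x \<in> hyp d" "y \<in> hyp d" "\<gamma> 0 = x" "\<gamma> 1 = y"
    using g unfolding hgeodesic_def by blast
  have ends: "x = hexp d x (\<lambda>i. (t + - t) * v i)" "y = hexp d x (\<lambda>i. (t + (1 - t)) * v i)"
    using \<gamma>[of 0] \<gamma>[of 1] unfolding xy by simp_all
  define m where "m = \<gamma> t"
  have mt: "m = hexp d x (\<lambda>i. t * v i)" using \<gamma> t by (simp add: m_def)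
  obtain w where w: "w \<in> tangent d m"
    and e: "\<And>s. hexp d m (\<lambda>i. s * w i) = hexp d x (\<lambda>i. (t + s) * v i)"
    using hexp_reparametrize[OF xy(1) v, of t] unfolding mt by blast
  have m: "m \<in> hyp d" unfolding mt by (rule hexp_in_hyp[OF xy(1) tangent_scale[OF v]])
  have lx: "hlog d m x = (\<lambda>i. - t * w i)"
    by (subst ends(1), subst e[symmetric]) (rule hlog_hexp[OF m tangent_scale[OF w]])
  have ly: "hlog d m y = (\<lambda>i. (1 - t) * w i)"
    by (subst ends(2), subst e[symmetric]) (rule hlog_hexp[OF m tangent_scale[OF w]])
  obtain g where g: "g \<in> subdifferential d f m" using assms[OF m] by blast
  then have sub: "f z \<ge> f m + mink d g (hlog d m z)" if "z \<in> hyp d" for z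
    using that unfolding subdifferential_def by blast
  have "f x \<ge> f m - t * mink d g w" "f y \<ge> f m + (1 - t) * mink d g w"
    using sub[OF xy(1)] sub[OF xy(2)] unfolding lx ly mink_scale_right by simp_all
  then have "(1 - t) * (f m - t * mink d g w) + t * (f m + (1 - t) * mink d g w)
      \<le> (1 - t) * f x + t * f y"
    using t by (intro add_mono mult_left_mono) auto
  then show "f (\<gamma> t) \<le> (1 - t) * f x + t * f y"
    unfolding m_def[symmetric] by (simp add: algebra_simps)
qed

lemma h_lipschitz_if_bounded_subgradients:
  assumes "\<And>x. x \<in> hyp d \<Longrightarrow> \<exists>g \<in> subdifferential d f x. hnorm d g \<le> M"
  shows "h_lipschitz d M f"
proof -
  have *: "f x - f y \<le> M * hdist d x y" if x: "x \<in> hyp d" and y: "y \<in> hyp d" for x y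
  proof -
    obtain g where g: "g \<in> subdifferential d f x" "hnorm d g \<le> M" using assms[OF x] by blast
    then have gt: "g \<in> tangent d x" and sub: "f y \<ge> f x + mink d g (hlog d x y)"
      using y by (auto simp: subdifferential_def)
    note l = hlog_in_tangent[OF x y]
    have "f x - f y \<le> \<bar>mink d g (hlog d x y)\<bar>" using sub by linarith
    also have "\<dots> \<le> hnorm d g * hnorm d (hlog d x y)" by (rule mink_Cauchy_Schwarz[OF x gt l])
    also have "\<dots> \<le> M * hnorm d (hlog d x y)"
      using g(2) hnorm_squared(2)[OF x l] by (rule mult_right_mono)
    finally show ?thesis by (simp add: hnorm_hlog[OF x y])
  qed
  show ?thesis unfolding h_lipschitz_def
  proof (intro ballI)
    fix x y assume "x \<in> hyp d" "y \<in> hyp d"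
    then show "\<bar>f x - f y\<bar> \<le> M * hdist d x y"
      using *[of x y] *[of y x] by (simp add: hdist_commute abs_le_iff)
  qed
qed


section \<open>Maxima of scaled signed distances to hyperplanes\<close>

text \<open>For a spacelike unit vector \<open>n\<close>, \<open>arsinh (mink d n x)\<close> is the signed distance from \<open>x\<close> to
  the hyperplane with normal \<open>n\<close>, and \<open>wall_grad d n x\<close> is its Riemannian gradient.\<close>

definition wall_grad :: "nat \<Rightarrow> vec \<Rightarrow> vec \<Rightarrow> vec" where
  "wall_grad d n x = (let a = arsinh (mink d n x) in (\<lambda>i. 1 / cosh a * n i + tanh a * x i))"

text \<open>With \<open>mink d n x = sinh a\<close>, the tangential part of \<open>n\<close> at
  \<open>x\<close> is \<open>n + sinh a * x\<close>, of length \<open>cosh a\<close>;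
  \<open>wall_grad\<close> is its normalization.\<close>

lemma wall_grad:
  assumes x: "x \<in> hyp d" and n: "\<forall>i>d. n i = 0" "mink d n n = 1"
  shows "wall_grad d n x \<in> tangent d x" "hnorm d (wall_grad d n x) = 1"
    and "v \<in> tangent d x \<Longrightarrow>
      mink d (wall_grad d n x) v = mink d n v / cosh (arsinh (mink d n x))"
proof -
  define a where "a = arsinh (mink d n x)"
  have nx: "mink d n x = sinh a" "mink d x n = sinh a" by (simp_all add: a_def mink_commute)
  have xx: "mink d x x = -1" using x by (simp add: hyp_def)
  have w: "wall_grad d n x = (\<lambda>i. 1 / cosh a * n i + tanh a * x i)"
    by (simp only: wall_grad_def a_def Let_def)
  have "mink d x (wall_grad d n x) = 0"
    unfolding w mink_lincomb_right nx xx by (simp add: tanh_def)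
  moreover have "\<forall>i>d. wall_grad d n x i = 0" using x n by (simp add: w hyp_def)
  ultimately show "wall_grad d n x \<in> tangent d x" by (simp add: tangent_def)
  have "mink d (wall_grad d n x) (wall_grad d n x) = (1 + (sinh a)\<^sup>2) / (cosh a)\<^sup>2"
    unfolding w mink_lincomb_right mink_lincomb_left nx xx n
    by (simp add: tanh_def power2_eq_square field_simps)
  also have "1 + (sinh a)\<^sup>2 = (cosh a)\<^sup>2" by (simp add: cosh_square_eq)
  also have "(cosh a)\<^sup>2 / (cosh a)\<^sup>2 = 1" by simp
  finally show "hnorm d (wall_grad d n x) = 1" by (simp add: hnorm_def)
  show "mink d (wall_grad d n x) v = mink d n v / cosh (arsinh (mink d n x))"
    if "v \<in> tangent d x"
    using that unfolding w mink_lincomb_left a_def[symmetric] by (simp add: tangent_def)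
qed

text \<open>Signed distance to a hyperplane is convex only on its nonnegative side, hence the
  \<open>max 0\<close>. If \<open>a + s > 0\<close>, applying \<open>sinh\<close> to both sides
  reduces the claim to \<open>sinh_add_le\<close>.\<close>

lemma wall_grad_subgradient:
  assumes x: "x \<in> hyp d" and y: "y \<in> hyp d" and n: "\<forall>i>d. n i = 0" "mink d n n = 1"
    and a: "arsinh (mink d n x) \<ge> 0"
  shows "arsinh (mink d n x) + mink d (wall_grad d n x) (hlog d x y)
    \<le> max 0 (arsinh (mink d n y))"
proof -
  define a where "a = arsinh (mink d n x)"
  define v where "v = hlog d x y"
  define l where "l = hnorm d v"
  define s where "s = mink d (wall_grad d n x) v"
  have v: "v \<in> tangent d x" unfolding v_def by (rule hlog_in_tangent[OF x y])
  have yv: "y = hexp d x v" by (simp add: v_def hexp_hlog[OF x y])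
  note g = wall_grad[OF x n]
  have sl: "\<bar>s\<bar> \<le> l"
    using mink_Cauchy_Schwarz[OF x g(1) v] g(2) by (simp add: s_def l_def)
  have a0: "a \<ge> 0" and nx: "mink d n x = sinh a" using a by (simp_all add: a_def)
  have nv: "mink d n v = cosh a * s" using g(3)[OF v] by (simp add: s_def a_def)
  have ny: "mink d n y = sinh a * cosh l + cosh a * (sinh l / l * s)"
    unfolding yv hexp_def mink_lincomb_right nx nv l_def[symmetric] by simp
  have "a + s \<le> max 0 (arsinh (mink d n y))"
  proof (cases "a + s \<le> 0")
    case False
    have "sinh (a + s) \<le> mink d n y"
    proof (cases "l = 0")
      case True
      then show ?thesis using sl by (simp add: ny)
    next
      case l: False
      then show ?thesis unfolding ny using False sl a0 by (intro sinh_add_le) auto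
    qed
    then have "sinh (a + s) \<le> sinh (arsinh (mink d n y))" by simp
    then have "a + s \<le> arsinh (mink d n y)" by (simp only: sinh_real_le_iff)
    then show ?thesis by simp
  qed simp
  then show ?thesis by (simp add: a_def s_def v_def)
qed

text \<open>The value 0 for the empty list turns signed distances into distances to half-spaces and
  supplies the positive part needed for convexity.\<close>

primrec walls :: "nat \<Rightarrow> real \<Rightarrow> vec list \<Rightarrow> vec \<Rightarrow> real" where
  "walls d M [] x = 0"
| "walls d M (n # N) x = max (walls d M N x) (M * arsinh (mink d n x))"

text \<open>Ties are broken in favour of the tail of the list, so that a new wall that is not strictly
  dominant at \<open>x\<close> leaves the oracle's answer at \<open>x\<close> unchanged.\<close>

primrec walls_oracle :: "nat \<Rightarrow> real \<Rightarrow> vec list \<Rightarrow> vec \<Rightarrow> vec" where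
  "walls_oracle d M [] x = (\<lambda>_. 0)"
| "walls_oracle d M (n # N) x =
    (if M * arsinh (mink d n x) \<le> walls d M N x then walls_oracle d M N x
     else (\<lambda>i. M * wall_grad d n x i))"

lemma walls_nonneg: "walls d M N x \<ge> 0"
  by (induction N) auto

text \<open>A subgradient of the active branch is one of the maximum. A new wall is active only if
  it strictly exceeds the nonnegative older value, so its signed distance is positive there, as
  \<open>wall_grad_subgradient\<close> requires.\<close>

lemma walls_oracle:
  assumes x: "x \<in> hyp d" and M: "M > 0"
    and N: "\<And>n. n \<in> set N \<Longrightarrow> (\<forall>i>d. n i = 0) \<and> mink d n n = 1"
  shows "walls_oracle d M N x \<in> subdifferential d (walls d M N) x
    \<and> hnorm d (walls_oracle d M N x) \<le> M"
  using N
proof (induction N)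
  case Nil
  then show ?case using M by (simp add: subdifferential_def tangent_def hnorm_def)
next
  case (Cons n N)
  then have IH: "walls_oracle d M N x \<in> subdifferential d (walls d M N) x"
    "hnorm d (walls_oracle d M N x) \<le> M" and n: "\<forall>i>d. n i = 0" "mink d n n = 1"
    by auto
  show ?case
  proof (cases "M * arsinh (mink d n x) \<le> walls d M N x")
    case True
    then show ?thesis using IH by (fastforce simp: subdifferential_def max_def)
  next
    case False
    note g = wall_grad[OF x n]
    have "M * arsinh (mink d n x) > 0" using False walls_nonneg[of d M N x] by linarith
    then have a: "arsinh (mink d n x) \<ge> 0" using M by (auto simp: zero_less_mult_iff intro: less_imp_le)
    have "M * arsinh (mink d n x) + M * mink d (wall_grad d n x) (hlog d x y)
        \<le> walls d M (n # N) y" if y: "y \<in> hyp d" for y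
    proof -
      have "M * (arsinh (mink d n x) + mink d (wall_grad d n x) (hlog d x y))
          \<le> M * max 0 (arsinh (mink d n y))"
        using wall_grad_subgradient[OF x y n a] M by (intro mult_left_mono) auto
      also have "\<dots> \<le> walls d M (n # N) y"
        using walls_nonneg[of d M N y] by (auto simp: max_def)
      finally show ?thesis by (simp add: algebra_simps)
    qed
    moreover have "hnorm d (\<lambda>i. M * wall_grad d n x i) = M"
      using g(2) M by (simp add: hnorm_def mink_scale_left mink_scale_right real_sqrt_mult)
    ultimately show ?thesis using False tangent_scale[OF g(1)]
      by (auto simp: subdifferential_def mink_scale_left)
  qed
qed

section \<open>The resisting oracle\<close>

lemma homogeneous_system_solution:
  fixes L :: "('a \<Rightarrow> 'b :: field) list"
  assumes "finite I" "length L < card I"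
  shows "\<exists>v. (\<forall>i. i \<notin> I \<longrightarrow> v i = 0) \<and> v \<noteq> (\<lambda>_. 0) \<and> (\<forall>a\<in>set L. (\<Sum>i\<in>I. a i * v i) = 0)"
  using assms
proof (induction "length L" arbitrary: L I)
  case 0
  then obtain q where "q \<in> I" by fastforce
  then show ?case using 0
    by (intro exI[of _ "(\<lambda>_. 0)(q := 1)"]) (auto simp: fun_eq_iff)
next
  case (Suc k)
  then obtain a L' where L: "L = a # L'" and k: "k = length L'" by (cases L) auto
  show ?case
  proof (cases "\<forall>i\<in>I. a i = 0")
    case True
    obtain v where "(\<forall>i. i \<notin> I \<longrightarrow> v i = 0) \<and> v \<noteq> (\<lambda>_. 0)
        \<and> (\<forall>a\<in>set L'. (\<Sum>i\<in>I. a i * v i) = 0)"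
      using Suc.hyps(1)[OF k, of I] Suc.prems by (auto simp: L)
    then show ?thesis using True by (intro exI[of _ v]) (auto simp: L)
  next
    case False
    then obtain q where q: "q \<in> I" "a q \<noteq> 0" by blast
    \<comment> \<open>Gaussian elimination with pivot \<open>q\<close>: \<open>red b\<close>
      vanishes at \<open>q\<close>, so the reduced system lives on \<open>I - {q}\<close>. The value
      of \<open>w\<close> at \<open>q\<close> is then the one that solves equation
      \<open>a\<close>.\<close>
    define red where "red b i = b i - b q / a q * a i" for b :: "'a \<Rightarrow> 'b" and i
    have "finite (I - {q})" "length (map red L') < card (I - {q})"
      using Suc.prems q by (auto simp: L)
    then obtain v where v: "\<And>i. i \<notin> I - {q} \<Longrightarrow> v i = 0" "v \<noteq> (\<lambda>_. 0)"
      and eq: "\<And>b. b \<in> set L' \<Longrightarrow> (\<Sum>i\<in>I - {q}. red b i * v i) = 0"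
      using Suc.hyps(1)[of "map red L'" "I - {q}"] k by auto
    define w where "w = v(q := - (\<Sum>i\<in>I - {q}. a i * v i) / a q)"
    have split: "(\<Sum>i\<in>I. b i * w i) = b q * w q + (\<Sum>i\<in>I - {q}. b i * v i)" for b
      using Suc.prems q by (simp add: sum.remove[of I q] w_def)
    have a0: "(\<Sum>i\<in>I. a i * w i) = 0"
      unfolding split using q by (simp add: w_def)
    have "(\<Sum>i\<in>I. b i * w i) = 0" if "b \<in> set L'" for b
    proof -
      have "(\<Sum>i\<in>I - {q}. b i * v i)
          = (\<Sum>i\<in>I - {q}. red b i * v i) + b q / a q * (\<Sum>i\<in>I - {q}. a i * v i)"
        by (simp add: red_def algebra_simps sum_distrib_left flip: sum.distrib)
      then show ?thesis unfolding split eq[OF that] by (simp add: w_def)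
    qed
    moreover have "w \<noteq> (\<lambda>_. 0)"
    proof
      assume w0: "w = (\<lambda>_. 0)"
      have "v i = 0" for i using fun_cong[OF w0, of i] v(1)[of q] by (cases "i = q") (auto simp: w_def)
      then show False using v(2) by auto
    qed
    moreover have "\<forall>i. i \<notin> I \<longrightarrow> w i = 0" using v(1) q by (auto simp: w_def)
    ultimately show ?thesis using a0 by (intro exI[of _ w]) (auto simp: L)
  qed
qed

lemma unit_tangent_orthogonal_to:
  assumes p: "p \<in> hyp d" and U: "length U < d"
  obtains e where "e \<in> tangent d p" "mink d e e = 1" "\<And>u. u \<in> set U \<Longrightarrow> mink d e u = 0"
proof -
  \<comment> \<open>Lowering the index by the Minkowski form makes orthogonality an ordinary linear
    equation. Together with tangency at \<open>p\<close> there are at most \<open>d\<close> of them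
    in \<open>d + 1\<close> unknowns.\<close>
  define flat where "flat u i = (if i = 0 then - u 0 else u i)" for u :: vec and i :: nat
  have mink_flat: "mink d u v = (\<Sum>i\<in>{0..d}. flat u i * v i)" for u v
    by (simp add: mink_def flat_def sum.atLeast_Suc_atMost)
  have "length (map flat (p # U)) < card {0..d}" using U by simp
  from homogeneous_system_solution[OF _ this] obtain v where v: "\<And>i. i \<notin> {0..d} \<Longrightarrow> v i = 0"
    "v \<noteq> (\<lambda>_. 0)" and orth: "\<And>u. u \<in> set (p # U) \<Longrightarrow> mink d u v = 0"
    unfolding mink_flat by auto
  have vt: "v \<in> tangent d p" using v(1) orth[of p] by (auto simp: tangent_def)
  then have pos: "mink d v v > 0"
    using tangent_posdef[OF p vt] v(2) by (simp add: less_le)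
  define e where "e = (\<lambda>i. 1 / sqrt (mink d v v) * v i)"
  have "e \<in> tangent d p" unfolding e_def by (rule tangent_scale[OF vt])
  moreover have "mink d e e = 1"
    unfolding e_def mink_scale_left mink_scale_right using pos by simp
  moreover have "mink d e u = 0" if "u \<in> set U" for u
    using orth[of u] that unfolding e_def mink_scale_left by (simp add: mink_commute)
  ultimately show ?thesis by (rule that)
qed

text \<open>The unit normal of the hyperplane that is orthogonal to the geodesic through \<open>p\<close> with
  direction \<open>e\<close> and passes at distance \<open>artanh c\<close> behind \<open>p\<close>.\<close>

definition tilt :: "real \<Rightarrow> vec \<Rightarrow> vec \<Rightarrow> vec" where
  "tilt c p e = (\<lambda>i. 1 / sqrt (1 - c\<^sup>2) * e i + (- c / sqrt (1 - c\<^sup>2)) * p i)"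

lemma mink_tilt: "mink d (tilt c p e) x = (mink d e x - c * mink d p x) / sqrt (1 - c\<^sup>2)"
  unfolding tilt_def mink_lincomb_left by (simp add: diff_divide_distrib)

lemma tilt_unit:
  assumes "p \<in> hyp d" "e \<in> tangent d p" "mink d e e = 1" "\<bar>c\<bar> < 1"
  shows "(\<forall>i>d. tilt c p e i = 0) \<and> mink d (tilt c p e) (tilt c p e) = 1"
proof -
  have c: "1 - c\<^sup>2 > 0" using assms(4) by (simp add: abs_square_less_1)
  have e: "mink d e (tilt c p e) = 1 / sqrt (1 - c\<^sup>2)" "mink d p (tilt c p e) = c / sqrt (1 - c\<^sup>2)"
    using assms by (simp_all add: mink_commute[of d _ "tilt c p e"] mink_tilt tangent_def hyp_def
        mink_commute[of d e p])
  have "mink d (tilt c p e) (tilt c p e) = (1 - c * c) / (sqrt (1 - c\<^sup>2) * sqrt (1 - c\<^sup>2))"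
    unfolding mink_tilt e by (simp add: diff_divide_distrib)
  also have "\<dots> = 1" using c by (simp add: power2_eq_square)
  finally show ?thesis using assms by (simp add: tilt_def tangent_def hyp_def)
qed

text \<open>Agreement is needed only at the points queried in one of the runs, since by induction
  the other run queries the same points.\<close>

lemma query_history_cong:
  assumes "\<And>j. j < k \<Longrightarrow> f' (query_point A f G j) = f (query_point A f G j)"
    and "\<And>j. j < k \<Longrightarrow> G' (query_point A f G j) = G (query_point A f G j)"
  shows "query_history A f' G' k = query_history A f G k"
  using assms by (induction k) (simp_all add: Let_def query_point_def)

lemma query_point_in_hyp:
  assumes A: "first_order_algorithm d A" and G: "subgradient_oracle d f G"
  shows "query_point A f G k \<in> hyp d"
proof -
  have "query_history A f G k \<in> lists (UNIV \<times> tangent_bundle d)"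
  proof (induction k)
    case (Suc k)
    then have "A (query_history A f G k) \<in> hyp d"
      using A by (auto simp: first_order_algorithm_def)
    with Suc show ?case
      using G by (auto simp: Let_def tangent_bundle_def subgradient_oracle_def subdifferential_def)
  qed simp
  then show ?thesis using A by (auto simp: first_order_algorithm_def query_point_def)
qed

text \<open>\<open>S\<close> is the sum of the orthonormal directions \<open>E\<close>; keeping it in the invariant replaces
  the pairwise orthogonality of \<open>E\<close>. A new direction orthogonal to all points queried so far
  gives a wall whose value at those points is only the lower bound
  \<open>M * arsinh (- c * mink d p x / sqrt (1 - c\<^sup>2))\<close>, which the older walls already attain. Hence
  it does not change the earlier answers.\<close>

lemma resisting_directions:
  assumes p: "p \<in> hyp d" and k: "2 * k < d"
  shows "\<exists>E S. length E = k \<and> set E \<subseteq> tangent d p \<and> (\<forall>e\<in>set E. mink d e e = 1 \<and> mink d e S = 1)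
    \<and> S \<in> tangent d p \<and> mink d S S = real k
    \<and> (\<forall>j<k. let N = map (tilt c p) E; x = query_point A (walls d M N) (walls_oracle d M N) j
        in M * arsinh (- c * mink d p x / sqrt (1 - c\<^sup>2)) \<le> walls d M N x)"
  using k
proof (induction k)
  case 0
  show ?case by (intro exI[of _ "[]"] exI[of _ "\<lambda>_. 0"]) (simp add: tangent_def)
next
  case (Suc k)
  define lower where "lower x = M * arsinh (- c * mink d p x / sqrt (1 - c\<^sup>2))" for x
  have "2 * k < d" using Suc.prems by simp
  note IH = Suc.IH[OF this, unfolded Let_def, folded lower_def]
  obtain E S where E: "set E \<subseteq> tangent d p" "\<And>e. e \<in> set E \<Longrightarrow> mink d e e = 1 \<and> mink d e S = 1"
    and S: "S \<in> tangent d p" "mink d S S = real k" and len: "length E = k"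
    and lower: "\<And>j. j < k \<Longrightarrow> lower (query_point A (walls d M (map (tilt c p) E))
        (walls_oracle d M (map (tilt c p) E)) j) \<le> walls d M (map (tilt c p) E)
          (query_point A (walls d M (map (tilt c p) E)) (walls_oracle d M (map (tilt c p) E)) j)"
    using IH by blast
  define f G where "f = walls d M (map (tilt c p) E)" and "G = walls_oracle d M (map (tilt c p) E)"
  define q where "q = query_point A f G"
  \<comment> \<open>These are \<open>2 * k + 2\<close> vectors, which is why two dimensions are
    spent per round. Orthogonality to \<open>S\<close> and \<open>E\<close> keeps the inner products
    in the invariant; orthogonality to the queries hides the new wall.\<close>
  define U where "U = S # E @ map q [0..<Suc k]"
  have "length U < d" using Suc.prems len by (simp add: U_def)
  from unit_tangent_orthogonal_to[OF p this] obtain e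
    where e: "e \<in> tangent d p" "mink d e e = 1" and orth: "\<And>u. u \<in> set U \<Longrightarrow> mink d e u = 0"
    by blast
  define E' S' where "E' = e # E" and "S' = (\<lambda>i. 1 * S i + 1 * e i)"
  define f' G' where "f' = walls d M (map (tilt c p) E')" and "G' = walls_oracle d M (map (tilt c p) E')"
  have eS: "mink d e S = 0" "mink d S e = 0" using orth[of S] by (auto simp: U_def mink_commute)
  have eE: "mink d u e = 0" if "u \<in> set E" for u
    using orth[of u] that by (simp add: U_def mink_commute)
  have eq: "mink d e (q j) = 0" if "j \<le> k" for j
    using that by (intro orth) (simp add: U_def image_iff, metis atLeastLessThan_iff le_neq_implies_less zero_le)
  have new_wall: "M * arsinh (mink d (tilt c p e) (q j)) = lower (q j)" if "j \<le> k" for j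
    by (simp add: lower_def mink_tilt eq[OF that])
  have old: "lower (q j) \<le> f (q j)" if "j < k" for j
    using lower[OF that] by (simp add: q_def f_def G_def)
  have "f' (q j) = f (q j)" "G' (q j) = G (q j)" if "j < k" for j
    using old[OF that] that
    by (simp_all add: f'_def G'_def f_def G_def E'_def new_wall)
  \<comment> \<open>Query \<open>k\<close> is included: it depends only on the answers with index
    below \<open>k\<close>.\<close>
  then have q': "query_point A f' G' j = q j" if "j \<le> k" for j
    using query_history_cong[of j f' A f G G'] that by (simp add: q_def query_point_def)
  have "lower (q j) \<le> f' (q j)" if "j \<le> k" for j
    using new_wall[OF that] by (simp add: f'_def E'_def)
  then have "\<forall>j<Suc k. lower (query_point A f' G' j) \<le> f' (query_point A f' G' j)"
    by (simp add: q' less_Suc_eq_le)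
  moreover have "S' \<in> tangent d p" unfolding S'_def by (rule tangent_lincomb[OF S(1) e(1)])
  moreover have "mink d S' S' = real (Suc k)"
    unfolding S'_def mink_lincomb_left mink_lincomb_right eS S(2) e(2) by simp
  moreover have "\<forall>u\<in>set E'. mink d u u = 1 \<and> mink d u S' = 1"
    unfolding S'_def mink_lincomb_right E'_def using E(2) eE eS e(2) by auto
  moreover have "set E' \<subseteq> tangent d p" using E(1) e(1) by (simp add: E'_def)
  moreover have "length E' = Suc k" using len by (simp add: E'_def)
  ultimately show ?case
    by (intro exI[of _ E'] exI[of _ S']) (simp add: Let_def f'_def G'_def lower_def)
qed

section \<open>The hard instance and its optimality gap\<close>

theorem theorem8:
  fixes r M :: real and T :: nat
    and x_ref :: "nat \<Rightarrow> vec"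
    and A :: "nat \<Rightarrow> history \<Rightarrow> vec"
  assumes "r > 0" and "M > 0" and "T > 0"
    and "\<And>d. d \<ge> 2 \<Longrightarrow> x_ref d \<in> hyp d"
    and "\<And>d. d \<ge> 2 \<Longrightarrow> first_order_algorithm d (A d)"
  shows "\<exists>d\<ge>2. \<exists>f \<in> lip_class d (x_ref d) r M. \<exists>G. subgradient_oracle d f G \<and>
           query_complexity d (M * r * (1 / (2 * zeta r * sqrt (real T)))) (A d) f G \<ge> enat T"
proof -
  define d where "d = 2 * T + 1"
  define p where "p = x_ref d"
  define c where "c = tanh r / sqrt (real T)"
  have d: "d \<ge> 2" "2 * T < d" using assms(3) by (auto simp: d_def)
  have p: "p \<in> hyp d" and A: "first_order_algorithm d (A d)" using assms d by (auto simp: p_def)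
  have sT: "sqrt (real T) \<ge> 1" "sqrt (real T) > 0" using assms(3) by auto
  have c: "0 < c" "c < 1"
  proof -
    show "0 < c" using assms(1) sT by (simp add: c_def)
    have "tanh r < sqrt (real T)" using tanh_real_lt_1[of r] sT by linarith
    then show "c < 1" using sT by (simp add: c_def)
  qed
  then have c2: "1 - c\<^sup>2 > 0" by (simp add: abs_square_less_1)
  obtain E S where E: "set E \<subseteq> tangent d p" "\<And>e. e \<in> set E \<Longrightarrow> mink d e e = 1 \<and> mink d e S = 1"
    and S: "S \<in> tangent d p" "mink d S S = real T"
    and low: "\<forall>j<T. let N = map (tilt c p) E; x = query_point (A d) (walls d M N) (walls_oracle d M N) j
        in M * arsinh (- c * mink d p x / sqrt (1 - c\<^sup>2)) \<le> walls d M N x"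
    using resisting_directions[OF p d(2), of c "A d" M] by blast
  define N where "N = map (tilt c p) E"
  define f G where "f = walls d M N" and "G = walls_oracle d M N"
  define q where "q = query_point (A d) f G"
  have N: "(\<forall>i>d. n i = 0) \<and> mink d n n = 1" if "n \<in> set N" for n
    using that E c tilt_unit[OF p, of _ c] by (auto simp: N_def)
  have G: "G x \<in> subdifferential d f x \<and> hnorm d (G x) \<le> M" if "x \<in> hyp d" for x
    unfolding f_def G_def by (rule walls_oracle[OF that assms(2) N])
  then have orc: "subgradient_oracle d f G" by (simp add: subgradient_oracle_def)

  define z where "z = hexp d p (\<lambda>i. - r / sqrt (real T) * S i)"
  have n: "hnorm d (\<lambda>i. - r / sqrt (real T) * S i) = r"
    unfolding hnorm_def mink_scale_left mink_scale_right S(2) using assms(1,3)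
    by (simp add: real_sqrt_mult)
  note zt = tangent_scale[OF S(1), of "- r / sqrt (real T)"]
  have z: "z \<in> hyp d" "hdist d p z = r"
    unfolding z_def using hexp_in_hyp[OF p zt] hdist_hexp[OF p zt] n by auto
  have pz: "mink d p z = - cosh r" unfolding z_def mink_x_hexp[OF p zt] n ..
  \<comment> \<open>The choice of \<open>c\<close> enters here:
    \<open>mink d e z = - sinh r / sqrt T\<close> cancels
    \<open>- c * mink d p z = tanh r * cosh r / sqrt T\<close>.\<close>
  have "mink d n z = 0" if nN: "n \<in> set N" for n
  proof -
    obtain e where e: "e \<in> set E" "n = tilt c p e" using nN by (auto simp: N_def)
    have "mink d e z = - sinh r / sqrt (real T)"
      unfolding z_def hexp_def n mink_lincomb_right mink_scale_right
      using E e(1) assms(1) by (auto simp: tangent_def mink_commute[of d e p])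
    then show ?thesis unfolding e mink_tilt pz by (simp add: c_def tanh_def)
  qed
  then have "walls d M N z = 0" by (induction N) auto
  then have fz: "f z = 0" by (simp add: f_def)
  have f0: "f y \<ge> 0" for y by (simp add: f_def walls_nonneg)
  have hmin: "h_min d f = 0"
    unfolding h_min_def using z(1) fz f0 by (intro Least_equality) (auto simp: image_iff intro: bexI[of _ z])
  have "g_convex d f" using G by (intro g_convex_if_subgradients) blast
  moreover have "h_lipschitz d M f" using G by (intro h_lipschitz_if_bounded_subgradients) blast
  ultimately have "f \<in> lip_class d (x_ref d) r M"
    unfolding lip_class_def using z fz f0 by (auto simp: hball_def p_def intro!: bexI[of _ z])
  moreover have "enat T \<le> query_complexity d (M * r * (1 / (2 * zeta r * sqrt (real T)))) (A d) f G"
    unfolding query_complexity_def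
  proof (rule Inf_greatest, clarify)
    fix k assume k: "f (query_point (A d) f G k) - h_min d f \<le> M * r * (1 / (2 * zeta r * sqrt (real T)))"
    have "M * r * (1 / (2 * zeta r * sqrt (real T))) = M * (c / 2)"
      using assms(1) by (simp add: zeta_def c_def)
    with k have fk: "f (q k) \<le> M * (c / 2)" by (simp add: hmin q_def)
    show "enat T \<le> enat k"
    proof (rule ccontr)
      assume "\<not> enat T \<le> enat k"
      then have "M * arsinh (- c * mink d p (q k) / sqrt (1 - c\<^sup>2)) \<le> f (q k)"
        using low by (simp add: Let_def f_def G_def N_def q_def)
      \<comment> \<open>The distance from \<open>p\<close> to each wall, that is
        \<open>artanh c\<close>; hence \<open>c = tanh b \<le> b\<close>.\<close>
      define b where "b = arsinh (c / sqrt (1 - c\<^sup>2))"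
      have sb: "sinh b = c / sqrt (1 - c\<^sup>2)" by (simp add: b_def)
      have "b \<ge> 0" using c c2 by (simp add: b_def less_imp_le)
      have "(cosh b)\<^sup>2 = (1 / sqrt (1 - c\<^sup>2))\<^sup>2"
        unfolding cosh_square_eq sb using c2 by (simp add: power_divide field_simps)
      then have "cosh b = 1 / sqrt (1 - c\<^sup>2)" using c2 by (simp add: power2_eq_iff_nonneg)
      then have "tanh b = c" using c2 by (simp add: tanh_def sb)
      then have "c \<le> b" using tanh_le_self[OF \<open>b \<ge> 0\<close>] by simp
      have "q k \<in> hyp d" unfolding q_def by (rule query_point_in_hyp[OF A orc])
      \<comment> \<open>Since \<open>- mink d p x \<ge> 1\<close> on the hyperboloid, the lower
        bound at any query is at least its value \<open>M * b\<close> at \<open>p\<close>.\<close>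
      then have "c * 1 \<le> c * (- mink d p (q k))"
        using mink_hyp_le[OF p] c by (intro mult_left_mono) auto
      then have "c / sqrt (1 - c\<^sup>2) \<le> - c * mink d p (q k) / sqrt (1 - c\<^sup>2)"
        using c2 by (intro divide_right_mono) auto
      then have "b \<le> arsinh (- c * mink d p (q k) / sqrt (1 - c\<^sup>2))"
        unfolding b_def using arsinh_less_iff_real by (meson linorder_not_less)
      then have "M * c \<le> M * arsinh (- c * mink d p (q k) / sqrt (1 - c\<^sup>2))"
        using \<open>c \<le> b\<close> assms(2) by (intro mult_left_mono) auto
      also have "\<dots> \<le> f (q k)" by fact
      also have "\<dots> \<le> M * (c / 2)" by fact
      finally show False using assms(2) c by simp
    qed
  qed
  ultimately show ?thesis using d(1) orc by blast
qed

end
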